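(* Let $f\in B(I)$ and let $g=f_x$ be its associated function. Then, for every $n\in\mathbb{N}$, $$\left|L_n (f,x) - \frac{f(x+) + f(x-)}{2}\right|\leq |f(x) - f(x-)|\, P(Z_n (x) =0) + |f(x+) - f(x-)| \left| P(Z_n (x)>0) - \frac{1}{2}\right|+ C_n(\beta)\,\mathbb{E}\, \omega \left(g , \frac{X_\beta}{\sqrt{n}} \right).$$
   Context: $\mathbb{N}$ is the set of positive integers, $I$ is a real interval, and $x$ is a fixed point of the interior of $I$. $B(I)$ is the set of all measurable bounded functions $f:I\to\mathbb{R}$ whose right and left limits at $x$, denoted $f(x+)$ and $f(x-)$, exist and are finite. For $f\in B(I)$, its associated function $g=f_x$ is $$f_x(y)=(f(y)-f(x+))1_{I\cap(x,\infty)}(y)+(f(y)-f(x-))1_{I\cap(-\infty,x)}(y),\quad y\in I,$$ where $1_A$ is the indicator function of $A$; in particular $g(x)=0$. The local first modulus of continuity of $g$ at $x$ is $$\omega(g,\theta)=\sup\{|g(x+u)-g(x)|:\ x+u\in I,\ |u|\leq\theta\},\quad \theta\geq 0.$$ For each $n\in\mathbb{N}$, $Z_n(x)$ is a real random variable such that $x+Z_n(x)/\sqrt{n}$ takes values in $I$, and the positive linear operator $L_n$ is given by $$L_n(f,x)=\mathbb{E}\, f\left(x+\frac{Z_n(x)}{\sqrt{n}}\right)$$ for measurable $f:I\to\mathbb{R}$ for which the expectation is finite. Standing assumptions: there are positive constants $\beta$ and $C_n(\beta)$ (possibly depending on $x$) such that for all $n\in\mathbb{N}$ $$P(|Z_n(x)|\geq\theta)\leq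 C_n(\beta)\exp(-\beta\theta),\quad \theta\geq 0,$$ and $\lim_{n\to\infty}P(Z_n(x)>0)=\lim_{n\to\infty}P(Z_n(x)<0)=\frac12$. $X_\beta$ is a random variable with the exponential distribution of parameter $\beta$, i.e. $P(X_\beta\leq y)=1-\exp(-\beta y)$ for $y\geq 0$. *)

theory Defs
  imports "HOL-Probability.Probability"
begin

text \<open>A function on a real interval \<open>I\<close> is represented by a total function
  \<open>real \<Rightarrow> real\<close> of which only the values on \<open>I\<close> matter. The base point \<open>x\<close> is always an
  interior point of \<open>I\<close>, so that the one-sided limits at \<open>x\<close> only involve values on \<open>I\<close>.\<close>

definition right_lim :: "(real \<Rightarrow> real) \<Rightarrow> real \<Rightarrow> real" where
  "right_lim f x = Lim (at_right x) f"

definition left_lim :: "(real \<Rightarrow> real) \<Rightarrow> real \<Rightarrow> real" where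
  "left_lim f x = Lim (at_left x) f"

definition B_space :: "real set \<Rightarrow> real \<Rightarrow> (real \<Rightarrow> real) set" where
  "B_space I x = {f. f \<in> borel_measurable (restrict_space borel I) \<and> bounded (f ` I) \<and>
     (\<exists>r. (f \<longlongrightarrow> r) (at_right x)) \<and> (\<exists>l. (f \<longlongrightarrow> l) (at_left x))}"

definition assoc_fun :: "real set \<Rightarrow> real \<Rightarrow> (real \<Rightarrow> real) \<Rightarrow> real \<Rightarrow> real" where
  "assoc_fun I x f y =
     (f y - right_lim f x) * indicator (I \<inter> {x<..}) y +
     (f y - left_lim f x) * indicator (I \<inter> {..<x}) y"

text \<open>Only used for \<open>\<theta> \<ge> 0\<close> and \<open>g\<close> bounded on \<open>I\<close>, where the supremum is over a
  nonempty bounded set.\<close>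

definition local_modulus :: "real set \<Rightarrow> real \<Rightarrow> (real \<Rightarrow> real) \<Rightarrow> real \<Rightarrow> real" where
  "local_modulus I x g \<theta> = Sup {\<bar>g (x + u) - g x\<bar> | u. x + u \<in> I \<and> \<bar>u\<bar> \<le> \<theta>}"

text \<open>The random variables \<open>Z n\<close> may live on different probability spaces \<open>M n\<close>.\<close>

definition L_op :: "(nat \<Rightarrow> 'w measure) \<Rightarrow> (nat \<Rightarrow> 'w \<Rightarrow> real) \<Rightarrow> nat \<Rightarrow>
    (real \<Rightarrow> real) \<Rightarrow> real \<Rightarrow> real" where
  "L_op M Z n f x = (\<integral>w. f (x + Z n w / sqrt (real n)) \<partial>M n)"

end

theory Submission
  imports Defs
begin

text \<open>Write \<open>Y = x + Z n / sqrt n\<close>. On the events \<open>Z n > 0\<close>, \<open>Z n < 0\<close> and \<open>Z n = 0\<close> the value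
  \<open>f Y\<close> is \<open>g Y\<close> plus, respectively, the right limit of \<open>f\<close>, its left limit, and \<open>f x\<close>. Taking
  expectations, and eliminating \<open>P(Z n < 0)\<close> because the three probabilities add up to one, the
  deviation of \<open>L_op M Z n f x\<close> from the mean of the one-sided limits is exactly
  \<open>(f(x) - f(x-)) P(Z n = 0) + (f(x+) - f(x-)) (P(Z n > 0) - 1/2) + E g(Y)\<close>.

  It remains to bound \<open>E g(Y)\<close>. Since \<open>g x = 0\<close>, the absolute value of \<open>g Y\<close> is at most the
  modulus of continuity \<open>\<omega>\<close> of \<open>g\<close> at \<open>\<bar>Z n\<bar> / sqrt n\<close>, and \<open>\<omega>\<close> is a nondecreasing function
  vanishing at zero. The tail assumption says \<open>P(\<bar>Z n\<bar> \<ge> a) \<le> C n P(X > a)\<close> for all \<open>a \<ge> 0\<close>,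
  because \<open>X\<close> is exponentially distributed with parameter \<open>\<beta>\<close>.
  Such a comparison of tails passes to expectations of nondecreasing functions
  (\<open>integral_mono_fun_le_of_tail\<close>), because the super-level sets of a nondecreasing function are
  half-lines and an expectation is the integral of the measures of the super-level sets
  (\<open>nn_integral_layer_cake\<close>).\<close>

section \<open>Comparing expectations through tails\<close>

text \<open>The positive part of a number \<open>y\<close> is the length of the set of all \<open>t \<ge> 0\<close> below \<open>y\<close>; put
  \<open>y = f w\<close> and exchange the order of integration. Both sides ignore negative values of \<open>f\<close>.\<close>

lemma nn_integral_layer_cake:
  fixes f :: "'a \<Rightarrow> real"
  assumes "sigma_finite_measure M" and [measurable]: "f \<in> borel_measurable M"
  shows "(\<integral>\<^sup>+ w. ennreal (f w) \<partial>M)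
    = (\<integral>\<^sup>+ t. emeasure M {w \<in> space M. t < f w} * indicator {0..} t \<partial>lborel)"
proof -
  interpret sigma_finite_measure M by fact
  interpret pair_sigma_finite lborel M ..
  have "(\<integral>\<^sup>+ w. ennreal (f w) \<partial>M) = (\<integral>\<^sup>+ w. emeasure lborel {0..<f w} \<partial>M)"
  proof (intro nn_integral_cong)
    fix w show "ennreal (f w) = emeasure lborel {0..<f w}"
      by (cases "0 \<le> f w") (auto simp: ennreal_neg)
  qed
  also have "\<dots> = (\<integral>\<^sup>+ w. (\<integral>\<^sup>+ t. indicator {0..} t * indicator {..<f w} t \<partial>lborel) \<partial>M)"
  proof (intro nn_integral_cong)
    fix w
    have "emeasure lborel {0..<f w} = (\<integral>\<^sup>+ t. indicator {0..<f w} t \<partial>lborel)"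
      by simp
    also have "\<dots> = (\<integral>\<^sup>+ t. indicator {0..} t * indicator {..<f w} t \<partial>lborel)"
      by (intro nn_integral_cong) (auto simp: indicator_def)
    finally show "emeasure lborel {0..<f w}
      = (\<integral>\<^sup>+ t. indicator {0..} t * indicator {..<f w} t \<partial>lborel)" .
  qed
  also have "\<dots> = (\<integral>\<^sup>+ t. (\<integral>\<^sup>+ w. indicator {0..} t * indicator {..<f w} t \<partial>M) \<partial>lborel)"
    by (rule Fubini', measurable, simp)
  also have "\<dots> = (\<integral>\<^sup>+ t. emeasure M {w \<in> space M. t < f w} * indicator {0..} t \<partial>lborel)"
  proof (intro nn_integral_cong)
    fix t :: real
    have "(\<integral>\<^sup>+ w. indicator {0..} t * indicator {..<f w} t \<partial>M)
      = (\<integral>\<^sup>+ w. indicator {0..} t * indicator {w \<in> space M. t < f w} w \<partial>M)"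
      by (intro nn_integral_cong) (auto simp: indicator_def)
    also have "\<dots> = emeasure M {w \<in> space M. t < f w} * indicator {0..} t"
      by (subst nn_integral_cmult_indicator) (auto simp: mult.commute)
    finally show "(\<integral>\<^sup>+ w. indicator {0..} t * indicator {..<f w} t \<partial>M)
      = emeasure M {w \<in> space M. t < f w} * indicator {0..} t" .
  qed
  finally show ?thesis .
qed

text \<open>For \<open>t \<ge> 0\<close> the set where \<open>h > t\<close>, if nonempty, is a half-line in the positive reals, with or
  without its end point \<open>a\<close>. It lies between the open and the closed half-line at \<open>a\<close>, so that comparing
  closed half-lines for \<open>U\<close> with open ones for \<open>V\<close> covers both cases.\<close>

lemma integral_mono_fun_le_of_tail:
  fixes h :: "real \<Rightarrow> real"
  assumes "prob_space M" and U: "U \<in> borel_measurable M"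
    and "prob_space N" and V: "V \<in> borel_measurable N"
    and tail: "\<And>a. a \<ge> 0 \<Longrightarrow> \<P>(w in M. U w \<ge> a) \<le> C * \<P>(v in N. V v > a)"
    and "C \<ge> 0" and h: "mono h" and h0: "\<And>u. u \<le> 0 \<Longrightarrow> h u = 0" and hB: "\<And>u. h u \<le> B"
  shows "(\<integral>w. h (U w) \<partial>M) \<le> C * (\<integral>v. h (V v) \<partial>N)"
proof -
  interpret M: prob_space M by fact
  interpret N: prob_space N by fact
  note [measurable] = U V borel_measurable_mono[OF h]
  have h_nonneg: "h u \<ge> 0" for u
    using monoD[OF h, of "min u 0" u] h0[of "min u 0"] by simp
  have level: "emeasure M {w \<in> space M. t < h (U w)} \<le> C * emeasure N {v \<in> space N. t < h (V v)}"
    if t: "t \<ge> 0" for t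
  proof (cases "\<exists>u. t < h u")
    case False
    then show ?thesis by simp
  next
    case True
    define S where "S = {u. t < h u}"
    define a where "a = Inf S"
    have pos: "u > 0" if "u \<in> S" for u
      using that h0[of u] t by (force simp: S_def not_le[symmetric])
    have "S \<noteq> {}" using True by (auto simp: S_def)
    have bdd: "bdd_below S" by (rule bdd_belowI[of _ 0]) (use pos in force)
    have "a \<ge> 0" unfolding a_def using \<open>S \<noteq> {}\<close> pos by (intro cInf_greatest) force+
    have lower: "a \<le> u" if "t < h u" for u
      unfolding a_def using that bdd by (intro cInf_lower) (auto simp: S_def)
    have upper: "t < h u" if less: "a < u" for u
    proof -
      obtain s where "s \<in> S" "s < u"
        using less cInf_less_iff[OF \<open>S \<noteq> {}\<close> bdd, of u] unfolding a_def by blast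
      then show ?thesis using monoD[OF h, of s u] by (auto simp: S_def)
    qed
    have "M.prob {w \<in> space M. t < h (U w)} \<le> \<P>(w in M. U w \<ge> a)"
      by (intro M.finite_measure_mono) (auto intro: lower)
    also have "\<dots> \<le> C * \<P>(v in N. V v > a)" by (rule tail) fact
    also have "\<dots> \<le> C * N.prob {v \<in> space N. t < h (V v)}"
      using \<open>C \<ge> 0\<close> by (intro mult_left_mono N.finite_measure_mono) (auto intro: upper)
    finally show ?thesis
      using \<open>C \<ge> 0\<close>
      by (simp add: M.emeasure_eq_measure N.emeasure_eq_measure ennreal_mult'[symmetric])
  qed
  have int: "integrable M (\<lambda>w. h (U w))" "integrable N (\<lambda>v. h (V v))"
    using h_nonneg hB by (auto intro!: M.integrable_const_bound[where B = B]
        N.integrable_const_bound[where B = B])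
  have "ennreal (\<integral>w. h (U w) \<partial>M) = (\<integral>\<^sup>+ w. h (U w) \<partial>M)"
    using int h_nonneg by (simp add: nn_integral_eq_integral)
  also have "\<dots> = (\<integral>\<^sup>+ t. emeasure M {w \<in> space M. t < h (U w)} * indicator {0..} t \<partial>lborel)"
    by (intro nn_integral_layer_cake M.sigma_finite_measure_axioms) measurable
  also have "\<dots> \<le> (\<integral>\<^sup>+ t. C * (emeasure N {v \<in> space N. t < h (V v)} * indicator {0..} t) \<partial>lborel)"
    using level by (intro nn_integral_mono) (auto simp: indicator_def)
  also have "\<dots> = C * (\<integral>\<^sup>+ t. emeasure N {v \<in> space N. t < h (V v)} * indicator {0..} t \<partial>lborel)"
    by (intro nn_integral_cmult) measurable
  also have "\<dots> = C * (\<integral>\<^sup>+ v. h (V v) \<partial>N)"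
    by (subst nn_integral_layer_cake[OF N.sigma_finite_measure_axioms]) auto
  also have "\<dots> = ennreal (C * (\<integral>v. h (V v) \<partial>N))"
    using int h_nonneg \<open>C \<ge> 0\<close> by (simp add: nn_integral_eq_integral ennreal_mult')
  finally show ?thesis
    using \<open>C \<ge> 0\<close> h_nonneg by (subst (asm) ennreal_le_iff) (auto intro!: mult_nonneg_nonneg)
qed

section \<open>The local modulus of continuity\<close>

lemma bdd_above_local_modulus:
  fixes g :: "real \<Rightarrow> real"
  assumes "\<And>y. y \<in> I \<Longrightarrow> \<bar>g y\<bar> \<le> B" and "x \<in> I"
  shows "bdd_above {\<bar>g (x + u) - g x\<bar> | u. x + u \<in> I \<and> \<bar>u\<bar> \<le> \<theta>}"
proof (rule bdd_aboveI[of _ "2 * B"])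
  fix z assume "z \<in> {\<bar>g (x + u) - g x\<bar> | u. x + u \<in> I \<and> \<bar>u\<bar> \<le> \<theta>}"
  then obtain u where "z = \<bar>g (x + u) - g x\<bar>" "x + u \<in> I" by auto
  then show "z \<le> 2 * B" using assms(1)[of "x + u"] assms(1)[of x] assms(2) by linarith
qed

lemma local_modulus_upper:
  fixes g :: "real \<Rightarrow> real"
  assumes "\<And>y. y \<in> I \<Longrightarrow> \<bar>g y\<bar> \<le> B" and "x \<in> I" and "x + u \<in> I" and "\<bar>u\<bar> \<le> \<theta>"
  shows "\<bar>g (x + u) - g x\<bar> \<le> local_modulus I x g \<theta>"
  unfolding local_modulus_def
  by (intro cSup_upper bdd_above_local_modulus[OF assms(1,2)]) (use assms in auto)

lemma local_modulus_le:
  fixes g :: "real \<Rightarrow> real"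
  assumes "\<And>y. y \<in> I \<Longrightarrow> \<bar>g y\<bar> \<le> B" and "x \<in> I" and "\<theta> \<ge> 0"
  shows "local_modulus I x g \<theta> \<le> 2 * B"
  unfolding local_modulus_def
proof (intro cSup_least)
  have "x + 0 \<in> I \<and> \<bar>0\<bar> \<le> \<theta>" using assms by simp
  then show "{\<bar>g (x + u) - g x\<bar> | u. x + u \<in> I \<and> \<bar>u\<bar> \<le> \<theta>} \<noteq> {}" by blast
next
  fix z assume "z \<in> {\<bar>g (x + u) - g x\<bar> | u. x + u \<in> I \<and> \<bar>u\<bar> \<le> \<theta>}"
  then obtain u where "z = \<bar>g (x + u) - g x\<bar>" "x + u \<in> I" by auto
  then show "z \<le> 2 * B" using assms(1)[of "x + u"] assms(1)[of x] assms(2) by linarith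
qed

lemma local_modulus_mono:
  fixes g :: "real \<Rightarrow> real"
  assumes "\<And>y. y \<in> I \<Longrightarrow> \<bar>g y\<bar> \<le> B" and "x \<in> I" and "0 \<le> \<theta>" and "\<theta> \<le> \<theta>'"
  shows "local_modulus I x g \<theta> \<le> local_modulus I x g \<theta>'"
  unfolding local_modulus_def
proof (intro cSup_subset_mono bdd_above_local_modulus[OF assms(1,2)])
  have "x + 0 \<in> I \<and> \<bar>0\<bar> \<le> \<theta>" using assms by simp
  then show "{\<bar>g (x + u) - g x\<bar> | u. x + u \<in> I \<and> \<bar>u\<bar> \<le> \<theta>} \<noteq> {}" by blast
qed (use assms(4) in auto)

lemma local_modulus_0:
  fixes g :: "real \<Rightarrow> real"
  assumes "x \<in> I"
  shows "local_modulus I x g 0 = 0"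
proof -
  have "{\<bar>g (x + u) - g x\<bar> | u. x + u \<in> I \<and> \<bar>u\<bar> \<le> 0} = {0}"
    using assms by auto
  then show ?thesis by (simp add: local_modulus_def)
qed

text \<open>As \<open>P(X > \<theta>) = exp (- \<beta> * \<theta>)\<close>, the tail bound is a comparison of \<open>\<bar>Z\<bar>\<close> with \<open>X\<close>. The function
  whose expectations are compared is \<open>h u = \<omega>(g, max 0 u / s)\<close>. The truncation makes it
  nondecreasing on the whole line, whereas the modulus of continuity at a negative argument is the
  supremum of the empty set, an unspecified number.\<close>

lemma integral_local_modulus_le_of_exponential_tail:
  assumes "prob_space M" and Z[measurable]: "Z \<in> borel_measurable M"
    and "prob_space N" and X: "distributed N lborel X (exponential_density \<beta>)" and "\<beta> > 0"
    and tail: "\<And>\<theta>. \<theta> \<ge> 0 \<Longrightarrow> \<P>(w in M. \<bar>Z w\<bar> \<ge> \<theta>) \<le> C * exp (- \<beta> * \<theta>)" and "C \<ge> 0"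
    and "s > 0" and "x \<in> I" and gB: "\<And>y. y \<in> I \<Longrightarrow> \<bar>g y\<bar> \<le> B"
  shows "integrable M (\<lambda>w. local_modulus I x g (\<bar>Z w\<bar> / s))"
    and "(\<integral>w. local_modulus I x g (\<bar>Z w\<bar> / s) \<partial>M) \<le> C * (\<integral>v. local_modulus I x g (X v / s) \<partial>N)"
proof -
  interpret M: prob_space M by fact
  interpret N: prob_space N by fact
  have X_meas[measurable]: "X \<in> borel_measurable N"
    using distributed_measurable[OF X] by simp
  define h where "h u = local_modulus I x g (max 0 u / s)" for u
  have h: "mono h"
    unfolding h_def using \<open>s > 0\<close>
    by (intro monoI local_modulus_mono[OF gB \<open>x \<in> I\<close>]) (auto intro!: divide_right_mono)
  note [measurable] = borel_measurable_mono[OF h]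
  have h0: "h u = 0" if "u \<le> 0" for u
    using that \<open>x \<in> I\<close> by (simp add: h_def local_modulus_0 max_def)
  have h_nonneg: "h u \<ge> 0" for u
    using monoD[OF h, of "min u 0" u] h0[of "min u 0"] by simp
  have hB: "h u \<le> 2 * B" for u
    unfolding h_def using \<open>s > 0\<close> by (intro local_modulus_le[OF gB \<open>x \<in> I\<close>]) auto
  have Z_h: "local_modulus I x g (\<bar>Z w\<bar> / s) = h \<bar>Z w\<bar>" for w
    by (simp add: h_def)
  show "integrable M (\<lambda>w. local_modulus I x g (\<bar>Z w\<bar> / s))"
    unfolding Z_h using h_nonneg hB by (auto intro!: M.integrable_const_bound[where B = "2 * B"])
  have gt: "\<P>(v in N. X v > a) = exp (- a * \<beta>)" if "a \<ge> 0" for a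
    by (rule N.exponential_distributedD_gt[OF X that \<open>\<beta> > 0\<close>])
  have "(\<integral>w. h \<bar>Z w\<bar> \<partial>M) \<le> C * (\<integral>v. h (X v) \<partial>N)"
  proof (rule integral_mono_fun_le_of_tail[where h = h and U = "\<lambda>w. \<bar>Z w\<bar>" and V = X and B = "2 * B"])
    show "\<P>(w in M. a \<le> \<bar>Z w\<bar>) \<le> C * \<P>(v in N. a < X v)" if "a \<ge> 0" for a
      using tail[OF that] gt[OF that] by (simp add: mult.commute)
  qed (use assms h h0 hB in auto)
  also have "(\<integral>v. h (X v) \<partial>N) = (\<integral>v. local_modulus I x g (X v / s) \<partial>N)"
  proof -
    have pos: "AE v in N. X v > 0"
      using N.AE_prob_1[of "{v \<in> space N. X v > 0}"] gt[of 0] by auto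
    have meas: "(\<lambda>v. local_modulus I x g (X v / s)) \<in> borel_measurable N"
    proof -
      \<comment> \<open>For negative arguments the modulus does not depend on the argument.\<close>
      have "local_modulus I x g (X v / s)
        = (if X v < 0 then local_modulus I x g (- 1) else h (X v))" for v
      proof (cases "X v < 0")
        case True
        then have "\<not> \<bar>u\<bar> \<le> X v / s" for u
          using \<open>s > 0\<close> divide_neg_pos[of "X v" s] abs_ge_zero[of u] by linarith
        moreover have "\<not> \<bar>u\<bar> \<le> - 1" for u :: real
          using abs_ge_zero[of u] by linarith
        ultimately show ?thesis using True by (simp add: local_modulus_def del: abs_le_iff)
      qed (auto simp: h_def max_def)
      then show ?thesis by simp
    qed
    show ?thesis
    proof (rule integral_cong_AE)
      show "AE v in N. h (X v) = local_modulus I x g (X v / s)"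
        using pos by (auto simp: h_def)
    qed (use meas in measurable)
  qed
  finally show "(\<integral>w. local_modulus I x g (\<bar>Z w\<bar> / s) \<partial>M)
      \<le> C * (\<integral>v. local_modulus I x g (X v / s) \<partial>N)"
    unfolding Z_h .
qed

section \<open>The error in terms of the associated function\<close>

lemma assoc_fun_self [simp]: "assoc_fun I x f x = 0"
  by (simp add: assoc_fun_def)

lemma decompose_assoc_fun:
  fixes f :: "real \<Rightarrow> real"
  assumes "y \<in> I"
  shows "f y = assoc_fun I x f y + right_lim f x * indicator {x<..} y
    + left_lim f x * indicator {..<x} y + f x * indicator {x} y"
  using assms by (auto simp: assoc_fun_def indicator_def)

lemma abs_assoc_fun_le:
  fixes f :: "real \<Rightarrow> real"
  assumes "y \<in> I" and "\<bar>f y\<bar> \<le> B"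
  shows "\<bar>assoc_fun I x f y\<bar> \<le> B + \<bar>right_lim f x\<bar> + \<bar>left_lim f x\<bar>"
  using assms by (auto simp: assoc_fun_def indicator_def)

text \<open>The exact form of the error: the jump terms come from the decomposition of \<open>f\<close> above, after
  substituting \<open>P(Z < 0) = 1 - P(Z > 0) - P(Z = 0)\<close>.\<close>

lemma integral_decompose_assoc_fun:
  assumes "prob_space M" and Z[measurable]: "Z \<in> borel_measurable M" and "s > 0"
    and range: "\<And>w. w \<in> space M \<Longrightarrow> x + Z w / s \<in> I"
    and f: "f \<in> borel_measurable (restrict_space borel I)"
    and fB: "\<And>y. y \<in> I \<Longrightarrow> \<bar>f y\<bar> \<le> B"
  shows "integrable M (\<lambda>w. assoc_fun I x f (x + Z w / s))"
    and "(\<integral>w. f (x + Z w / s) \<partial>M) - (right_lim f x + left_lim f x) / 2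
      = (f x - left_lim f x) * \<P>(w in M. Z w = 0)
        + (right_lim f x - left_lim f x) * (\<P>(w in M. Z w > 0) - 1 / 2)
        + (\<integral>w. assoc_fun I x f (x + Z w / s) \<partial>M)"
proof -
  interpret prob_space M by fact
  let ?Y = "\<lambda>w. x + Z w / s"
  let ?P = "{w \<in> space M. Z w > 0}" and ?N = "{w \<in> space M. Z w < 0}"
    and ?O = "{w \<in> space M. Z w = 0}"
  have "?Y \<in> measurable M (restrict_space borel I)"
    by (rule measurable_restrict_space2) (use range in auto)
  then have fY[measurable]: "(\<lambda>w. f (?Y w)) \<in> borel_measurable M"
    using f by (rule measurable_compose)
  have split: "f (?Y w) = assoc_fun I x f (?Y w) + right_lim f x * indicator ?P w
      + left_lim f x * indicator ?N w + f x * indicator ?O w" if "w \<in> space M" for w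
    using decompose_assoc_fun[OF range[OF that], of f x] that \<open>s > 0\<close>
    by (auto simp: indicator_def zero_less_divide_iff divide_less_0_iff)
  have "(\<lambda>w. assoc_fun I x f (?Y w)) \<in> borel_measurable M
    \<longleftrightarrow> (\<lambda>w. f (?Y w) - right_lim f x * indicator ?P w
      - left_lim f x * indicator ?N w - f x * indicator ?O w) \<in> borel_measurable M"
    by (intro measurable_cong) (use split in auto)
  also have \<dots> by measurable
  finally have gY[measurable]: "(\<lambda>w. assoc_fun I x f (?Y w)) \<in> borel_measurable M" .
  show int: "integrable M (\<lambda>w. assoc_fun I x f (?Y w))"
    using abs_assoc_fun_le[where f = f and x = x, OF range fB[OF range]]
    by (intro integrable_const_bound[where B = "B + \<bar>right_lim f x\<bar> + \<bar>left_lim f x\<bar>"]) auto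
  have "(\<integral>w. f (?Y w) \<partial>M) = (\<integral>w. assoc_fun I x f (?Y w) + right_lim f x * indicator ?P w
      + left_lim f x * indicator ?N w + f x * indicator ?O w \<partial>M)"
    by (intro Bochner_Integration.integral_cong) (use split in auto)
  also have "\<dots> = (\<integral>w. assoc_fun I x f (?Y w) \<partial>M) + right_lim f x * prob ?P
      + left_lim f x * prob ?N + f x * prob ?O"
  proof -
    have "integrable M (\<lambda>w. c * indicator A w)" "(\<integral>w. c * indicator A w \<partial>M) = c * prob A"
      if "A \<in> events" for c :: real and A
      using that by (auto simp: emeasure_eq_measure)
    moreover have "?P \<in> events" "?N \<in> events" "?O \<in> events" by measurable
    ultimately show ?thesis
      using int by simp
  qed
  finally have eq: "(\<integral>w. f (?Y w) \<partial>M) = \<dots>" .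
  have "1 = prob (?P \<union> ?N \<union> ?O)"
    unfolding prob_space[symmetric] by (intro arg_cong[where f = prob]) auto
  also have "\<dots> = prob (?P \<union> ?N) + prob ?O"
    by (intro finite_measure_Union) auto
  also have "prob (?P \<union> ?N) = prob ?P + prob ?N"
    by (intro finite_measure_Union) auto
  finally have N: "prob ?N = 1 - prob ?P - prob ?O" by simp
  show "(\<integral>w. f (?Y w) \<partial>M) - (right_lim f x + left_lim f x) / 2
      = (f x - left_lim f x) * prob ?O + (right_lim f x - left_lim f x) * (prob ?P - 1 / 2)
        + (\<integral>w. assoc_fun I x f (?Y w) \<partial>M)"
    unfolding eq N by (simp add: field_simps)
qed

theorem theorem3p2:
  fixes I :: "real set" and x \<beta> :: real and f :: "real \<Rightarrow> real"
    and M :: "nat \<Rightarrow> 'w measure" and Z :: "nat \<Rightarrow> 'w \<Rightarrow> real" and C :: "nat \<Rightarrow> real"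
    and N :: "'v measure" and X :: "'v \<Rightarrow> real"
  assumes "is_interval I" and "x \<in> interior I"
    and "\<And>n. n \<ge> 1 \<Longrightarrow> prob_space (M n)"
    and "\<And>n. n \<ge> 1 \<Longrightarrow> Z n \<in> borel_measurable (M n)"
    and "\<And>n w. n \<ge> 1 \<Longrightarrow> w \<in> space (M n) \<Longrightarrow> x + Z n w / sqrt (real n) \<in> I"
    and "\<beta> > 0" and "\<And>n. n \<ge> 1 \<Longrightarrow> C n > 0"
    and "\<And>n \<theta>. n \<ge> 1 \<Longrightarrow> \<theta> \<ge> 0 \<Longrightarrow> \<P>(w in M n. \<bar>Z n w\<bar> \<ge> \<theta>) \<le> C n * exp (- \<beta> * \<theta>)"
    and "(\<lambda>n. \<P>(w in M n. Z n w > 0)) \<longlonglongrightarrow> 1 / 2"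
    and "(\<lambda>n. \<P>(w in M n. Z n w < 0)) \<longlonglongrightarrow> 1 / 2"
    and "prob_space N" and "distributed N lborel X (exponential_density \<beta>)"
    and "f \<in> B_space I x"
  shows "\<forall>n\<ge>1. \<bar>L_op M Z n f x - (right_lim f x + left_lim f x) / 2\<bar>
    \<le> \<bar>f x - left_lim f x\<bar> * \<P>(w in M n. Z n w = 0)
      + \<bar>right_lim f x - left_lim f x\<bar> * \<bar>\<P>(w in M n. Z n w > 0) - 1 / 2\<bar>
      + C n * (\<integral>v. local_modulus I x (assoc_fun I x f) (X v / sqrt (real n)) \<partial>N)"
proof (intro allI impI)
  fix n :: nat assume n: "n \<ge> 1"
  define s where "s = sqrt (real n)"
  have "s > 0" using n by (simp add: s_def)
  have "x \<in> I" using assms(2) interior_subset by blast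
  have f: "f \<in> borel_measurable (restrict_space borel I)" and "bounded (f ` I)"
    using assms(13) by (auto simp: B_space_def)
  then obtain B where fB: "\<And>y. y \<in> I \<Longrightarrow> \<bar>f y\<bar> \<le> B"
    by (auto simp: bounded_iff)
  define g where "g = assoc_fun I x f"
  have gB: "\<bar>g y\<bar> \<le> B + \<bar>right_lim f x\<bar> + \<bar>left_lim f x\<bar>" if "y \<in> I" for y
    unfolding g_def by (intro abs_assoc_fun_le fB that)
  have "C n \<ge> 0" using assms(7)[OF n] by simp
  have range: "x + Z n w / s \<in> I" if "w \<in> space (M n)" for w
    unfolding s_def by (rule assms(5)[OF n that])
  note error = integral_decompose_assoc_fun[OF assms(3)[OF n] assms(4)[OF n] \<open>s > 0\<close> range f fB,
      folded g_def]
  note compare = integral_local_modulus_le_of_exponential_tail[OF assms(3)[OF n] assms(4)[OF n]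
      assms(11,12,6) assms(8)[OF n] \<open>C n \<ge> 0\<close> \<open>s > 0\<close> \<open>x \<in> I\<close> gB]
  have "\<bar>\<integral>w. g (x + Z n w / s) \<partial>M n\<bar> \<le> (\<integral>w. \<bar>g (x + Z n w / s)\<bar> \<partial>M n)"
    by (rule integral_abs_bound)
  also have "\<dots> \<le> (\<integral>w. local_modulus I x g (\<bar>Z n w\<bar> / s) \<partial>M n)"
  proof (intro integral_mono integrable_abs error(1) compare(1))
    fix w assume "w \<in> space (M n)"
    then show "\<bar>g (x + Z n w / s)\<bar> \<le> local_modulus I x g (\<bar>Z n w\<bar> / s)"
      using local_modulus_upper[where g = g and u = "Z n w / s" and \<theta> = "\<bar>Z n w\<bar> / s",
          OF gB \<open>x \<in> I\<close> range] \<open>s > 0\<close>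
      by (simp add: g_def)
  qed
  also have "\<dots> \<le> C n * (\<integral>v. local_modulus I x g (X v / s) \<partial>N)"
    by (rule compare(2))
  finally have bound: "\<bar>\<integral>w. g (x + Z n w / s) \<partial>M n\<bar>
    \<le> C n * (\<integral>v. local_modulus I x g (X v / s) \<partial>N)" .
  let ?p = "\<P>(w in M n. Z n w > 0)" and ?r = "\<P>(w in M n. Z n w = 0)"
  have "\<bar>L_op M Z n f x - (right_lim f x + left_lim f x) / 2\<bar>
    = \<bar>(f x - left_lim f x) * ?r + (right_lim f x - left_lim f x) * (?p - 1 / 2)
      + (\<integral>w. g (x + Z n w / s) \<partial>M n)\<bar>"
    using error(2) by (simp add: L_op_def s_def)
  also have "\<dots> \<le> \<bar>(f x - left_lim f x) * ?r\<bar> + \<bar>(right_lim f x - left_lim f x) * (?p - 1 / 2)\<bar>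
      + \<bar>\<integral>w. g (x + Z n w / s) \<partial>M n\<bar>"
    by linarith
  also have "\<dots> \<le> \<bar>f x - left_lim f x\<bar> * ?r + \<bar>right_lim f x - left_lim f x\<bar> * \<bar>?p - 1 / 2\<bar>
      + C n * (\<integral>v. local_modulus I x g (X v / s) \<partial>N)"
    using bound by (simp add: abs_mult)
  finally show "\<bar>L_op M Z n f x - (right_lim f x + left_lim f x) / 2\<bar>
    \<le> \<bar>f x - left_lim f x\<bar> * ?r + \<bar>right_lim f x - left_lim f x\<bar> * \<bar>?p - 1 / 2\<bar>
      + C n * (\<integral>v. local_modulus I x (assoc_fun I x f) (X v / sqrt (real n)) \<partial>N)"
    by (simp add: g_def s_def)
qed

end
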